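(* Let $p$ be a prime, let $A\subset\mathbb{F}_p^*$ and $B\subset\mathbb{F}_p$ with $|A|=\alpha$ and $|B|=\beta$. Then there are at least $\min(p,\alpha\beta+1)$ elements $a\in\mathbb{F}_p$ for which there exist $x\in \big(A\cup (A-A)\big)\setminus\{0\}$ and $y\in B-B$ such that $ax\equiv y\pmod{p}$.
   Context: For a set $X\subset\mathbb{F}_p$, the difference set is $X-X=\{u-v : u,v\in X\}$. $\mathbb{F}_p^*=\mathbb{F}_p\setminus\{0\}$.
   Formalization: The formal theorem additionally assumes that A is nonempty and |B| ≥ 2; otherwise the claim fails: if A or B is empty there are 0 such elements but the bound is 1, and if |B| = 1 only a = 0 qualifies while the bound is at least 2. *)

theory Defs
  imports "Berlekamp_Zassenhaus.Finite_Field"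
begin

(* Elementwise differences u - v, not the set-theoretic difference X - Y. *)
definition difference_set :: "'a::minus set \<Rightarrow> 'a set" where
  "difference_set X = {u - v | u v. u \<in> X \<and> v \<in> X}"

end

theory Submission
  imports Defs
begin

text \<open>
  Adjoin \<open>0\<close> to \<open>A\<close> to get \<open>A'\<close>, so that the elements in question are the finite slopes of the
  grid \<open>A' \<times> B\<close>. If \<open>s\<close> is not one of them and \<open>y = 1 / s\<close>, the values \<open>a - b y\<close>
  are pairwise distinct, so \<open>H\<^sub>y(X) = \<Prod>(X + b y - a)\<close> divides \<open>X\<^sup>p - X\<close>. The coefficient of
  \<open>X\<^sup>j\<close> in \<open>X\<^sup>p mod H\<^sub>y\<close> is a polynomial in \<open>y\<close> of degree at most \<open>p - j\<close>, whose leading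
  coefficient is that of \<open>X\<^sup>j\<close> in \<open>r = X\<^sup>p mod g\<^sup>k\<close>, where \<open>g = \<Prod>(X + b)\<close> and \<open>k = |A'|\<close>.
  For \<open>j = deg r\<close> it vanishes at all these \<open>y\<close>, so there are at most \<open>p - deg r\<close> of them. Finally
  \<open>g\<^bsup>k-1\<^esup>\<close> divides \<open>r' \<noteq> 0\<close>, so \<open>deg r > |A| |B|\<close>.
\<close>

section \<open>Polynomial families of bounded total degree\<close>

text \<open>A family of polynomials \<open>f y\<close> in \<open>X\<close> that is polynomial in \<open>y\<close> as well, of total
  degree at most \<open>d\<close>; \<open>t\<close> is its homogeneous part of degree \<open>d\<close>, dehomogenised at \<open>y = 1\<close>.\<close>

definition poly_family :: "nat \<Rightarrow> ('a::comm_ring_1 \<Rightarrow> 'a poly) \<Rightarrow> 'a poly \<Rightarrow> bool" where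
  "poly_family d f t \<longleftrightarrow> (\<exists>c. (\<forall>y j. coeff (f y) j = poly (c j) y) \<and>
     (\<forall>i j. i + j > d \<longrightarrow> coeff (c j) i = 0) \<and>
     (\<forall>i j. i + j = d \<longrightarrow> coeff (c j) i = coeff t j) \<and> (\<forall>j>d. coeff t j = 0))"

lemma poly_family_one: "poly_family 0 (\<lambda>_. 1) 1"
  unfolding poly_family_def
  by (rule exI[of _ "\<lambda>j. if j = 0 then 1 else 0"]) auto

lemma poly_family_diff:
  assumes "poly_family d f t" "poly_family d g u"
  shows "poly_family d (\<lambda>y. f y - g y) (t - u)"
proof -
  from assms obtain c e where
    "\<forall>y j. coeff (f y) j = poly (c j) y" "\<forall>i j. i + j > d \<longrightarrow> coeff (c j) i = 0"
    "\<forall>i j. i + j = d \<longrightarrow> coeff (c j) i = coeff t j" "\<forall>j>d. coeff t j = 0"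
    "\<forall>y j. coeff (g y) j = poly (e j) y" "\<forall>i j. i + j > d \<longrightarrow> coeff (e j) i = 0"
    "\<forall>i j. i + j = d \<longrightarrow> coeff (e j) i = coeff u j" "\<forall>j>d. coeff u j = 0"
    unfolding poly_family_def by auto
  then show ?thesis
    unfolding poly_family_def by (intro exI[of _ "\<lambda>j. c j - e j"]) simp
qed

lemma poly_family_shift:
  assumes "poly_family d f t"
  shows "poly_family (Suc d) (\<lambda>y. pCons 0 (f y)) (pCons 0 t)"
proof -
  from assms obtain c where c:
    "\<forall>y j. coeff (f y) j = poly (c j) y" "\<forall>i j. i + j > d \<longrightarrow> coeff (c j) i = 0"
    "\<forall>i j. i + j = d \<longrightarrow> coeff (c j) i = coeff t j" "\<forall>j>d. coeff t j = 0"
    unfolding poly_family_def by auto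
  then show ?thesis
    unfolding poly_family_def
    by (intro exI[of _ "\<lambda>j. case j of 0 \<Rightarrow> 0 | Suc i \<Rightarrow> c i"])
       (auto simp: coeff_pCons split: nat.split)
qed

lemma coeff_mult_top:
  fixes p q :: "'a::comm_ring_1 poly"
  assumes "degree p \<le> m" "degree q \<le> n"
  shows "coeff (p * q) (m + n) = coeff p m * coeff q n"
proof -
  have "coeff p i * coeff q (m + n - i) = (if i = m then coeff p m * coeff q n else 0)"
    if "i \<le> m + n" for i
    using assms that by (cases i m rule: linorder_cases) (auto simp: coeff_eq_0)
  then have "coeff (p * q) (m + n) = (\<Sum>i\<le>m + n. if i = m then coeff p m * coeff q n else 0)"
    unfolding coeff_mult by (intro sum.cong) auto
  then show ?thesis by simp
qed

text \<open>\<open>m\<close> is only a bound on the degree of \<open>q\<close>, so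
  \<open>coeff q m\<close> may vanish; remainder coefficients can drop in degree in this
  way.\<close>

lemma poly_family_smult:
  assumes "poly_family d f t" "degree q \<le> m"
  shows "poly_family (m + d) (\<lambda>y. smult (poly q y) (f y)) (smult (coeff q m) t)"
proof -
  from assms obtain c where c:
    "\<forall>y j. coeff (f y) j = poly (c j) y" "\<forall>i j. i + j > d \<longrightarrow> coeff (c j) i = 0"
    "\<forall>i j. i + j = d \<longrightarrow> coeff (c j) i = coeff t j" "\<forall>j>d. coeff t j = 0"
    unfolding poly_family_def by auto
  have deg: "degree (c j) \<le> d - j" for j
    by (rule degree_le) (use c(2) in auto)
  \<comment> \<open>Here the truncated bound \<open>d - j\<close> is 0 and would still allow a
    nonzero constant.\<close>
  have zero: "c j = 0" if "j > d" for j
    by (rule poly_eqI) (use c(2) that in auto)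
  have "coeff (q * c j) i = 0" if "i + j > m + d" for i j
  proof (cases "j > d")
    case False
    have "degree (q * c j) \<le> m + (d - j)"
      using degree_mult_le[of q "c j"] assms(2) deg[of j] by linarith
    then show ?thesis using that False by (intro coeff_eq_0) linarith
  qed (simp add: zero)
  moreover have "coeff (q * c j) i = coeff q m * coeff t j" if "i + j = m + d" for i j
  proof (cases "j > d")
    case False
    then have "i = m + (d - j)" using that by simp
    then show ?thesis using coeff_mult_top[OF assms(2) deg[of j]] c(3) False by simp
  qed (simp add: zero c)
  ultimately show ?thesis
    unfolding poly_family_def using c
    by (intro exI[of _ "\<lambda>j. q * c j"]) simp
qed

lemma poly_family_prod:
  assumes "finite I"
  shows "poly_family (card I) (\<lambda>y. \<Prod>i\<in>I. [:b i * y - a i, 1:]) (\<Prod>i\<in>I. [:b i, 1:])"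
  using assms
proof (induction I)
  case empty
  then show ?case using poly_family_one by simp
next
  case (insert i I)
  let ?f = "\<lambda>y. \<Prod>i\<in>I. [:b i * y - a i, 1:]" and ?t = "\<Prod>i\<in>I. [:b i, 1:]"
  \<comment> \<open>Multiplying by X + (b y - a) is a shift minus a scaling by a - b y; the top part
    of that scalar is -b.\<close>
  have "poly_family (1 + card I) (\<lambda>y. smult (poly [:a i, - b i:] y) (?f y))
      (smult (coeff [:a i, - b i:] 1) ?t)"
    by (rule poly_family_smult[OF insert.IH]) simp
  then have "poly_family (Suc (card I))
      (\<lambda>y. pCons 0 (?f y) - smult (poly [:a i, - b i:] y) (?f y))
      (pCons 0 ?t - smult (coeff [:a i, - b i:] 1) ?t)"
    using poly_family_shift[OF insert.IH] by (intro poly_family_diff) simp_all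
  moreover have "pCons 0 (?f y) - smult (poly [:a i, - b i:] y) (?f y)
      = [:b i * y - a i, 1:] * ?f y" for y
    by (simp add: algebra_simps smult_diff_left)
  moreover have "pCons 0 ?t - smult (coeff [:a i, - b i:] 1) ?t = [:b i, 1:] * ?t"
    by simp
  ultimately show ?case
    unfolding prod.insert[OF insert.hyps] card_insert_disjoint[OF insert.hyps] by (simp only:)
qed

section \<open>Powers of X modulo a monic family\<close>

text \<open>One step of long division: X times the old remainder has degree at most
  \<open>Suc n\<close>, and since \<open>h\<close> is monic a single multiple of it cancels that
  coefficient.\<close>

lemma monom_Suc_mod_monic:
  fixes h :: "'a::field poly"
  assumes "lead_coeff h = 1" "degree h = Suc n"
  shows "monom 1 (Suc m) mod h
    = pCons 0 (monom 1 m mod h) - smult (coeff (monom 1 m mod h) n) h"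
proof -
  let ?r = "monom 1 m mod h"
  let ?s = "pCons 0 ?r - smult (coeff ?r n) h"
  have h: "h \<noteq> 0" using assms by auto
  have r: "degree ?r < Suc n"
    using degree_mod_less'[OF h, of "monom 1 m"] assms by (cases "?r = 0") auto
  have "coeff ?s i = 0" if "i > n" for i
    using that r assms by (cases "i = Suc n") (auto simp: coeff_pCons coeff_eq_0 split: nat.split)
  then have "degree ?s < degree h"
    using degree_le[of n ?s] assms by simp
  then have "?s mod h = ?s" by (rule mod_poly_less)
  moreover have "?s mod h = monom 1 (Suc m) mod h"
  proof -
    have "h dvd ?s - [:0, 1:] * ?r" by (simp add: dvd_smult)
    then have "?s mod h = ([:0, 1:] * ?r) mod h" by (simp add: mod_eq_dvd_iff)
    also have "\<dots> = ([:0, 1:] * monom 1 m) mod h" by (rule mod_mult_right_eq)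
    also have "[:0, 1:] * monom (1::'a) m = monom 1 (Suc m)" by (simp add: monom_Suc)
    finally show ?thesis .
  qed
  ultimately show ?thesis by simp
qed

text \<open>In the division step the coefficient at \<open>n\<close> has degree at most
  \<open>m - n\<close> in y, and the family has total degree \<open>Suc n\<close>, so the correction
  has total degree \<open>Suc m\<close>, like the shift.\<close>

lemma poly_family_monom_mod:
  fixes f :: "'a::field \<Rightarrow> 'a poly"
  assumes f: "poly_family (Suc n) f t"
    and monic: "\<And>y. lead_coeff (f y) = 1" "\<And>y. degree (f y) = Suc n"
      "lead_coeff t = 1" "degree t = Suc n"
  shows "poly_family m (\<lambda>y. monom 1 m mod f y) (monom 1 m mod t)"
proof (induction m)
  case 0
  show ?case using poly_family_one monic by (simp add: mod_poly_less)
next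
  case (Suc m)
  let ?r = "\<lambda>y. monom 1 m mod f y" and ?u = "monom 1 m mod t"
  obtain c where c:
    "\<forall>y j. coeff (?r y) j = poly (c j) y" "\<forall>i j. i + j > m \<longrightarrow> coeff (c j) i = 0"
    "\<forall>i j. i + j = m \<longrightarrow> coeff (c j) i = coeff ?u j" "\<forall>j>m. coeff ?u j = 0"
    using Suc unfolding poly_family_def by auto
  have shift: "poly_family (Suc m) (\<lambda>y. pCons 0 (?r y)) (pCons 0 ?u)"
    by (rule poly_family_shift[OF Suc])
  show ?case
  proof (cases "n \<le> m")
    case True
    have "degree (c n) \<le> m - n" by (rule degree_le) (use c in auto)
    \<comment> \<open>The top coefficient of \<open>c n\<close> is \<open>coeff ?u n\<close>, so the
      top part obeys the same recursion, modulo \<open>t\<close>.\<close>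
    from poly_family_smult[OF f this]
    have "poly_family (Suc m) (\<lambda>y. smult (coeff (?r y) n) (f y)) (smult (coeff ?u n) t)"
      using c(1,3) True by simp
    from poly_family_diff[OF shift this] show ?thesis
      by (simp add: monom_Suc_mod_monic[OF monic(1,2)] monom_Suc_mod_monic[OF monic(3,4)])
  next
    case False
    have "c n = 0" by (rule poly_eqI) (use c False in auto)
    then have "coeff (?r y) n = 0" for y using c by simp
    moreover have "coeff ?u n = 0" using c False by simp
    ultimately show ?thesis using shift
      by (simp add: monom_Suc_mod_monic[OF monic(1,2)] monom_Suc_mod_monic[OF monic(3,4)])
  qed
qed

section \<open>Linear factors and arithmetic modulo p\<close>

lemma prod_linear_dvd:
  fixes q :: "'a::field poly"
  assumes "finite I" "inj_on z I" "\<And>i. i \<in> I \<Longrightarrow> poly q (z i) = 0"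
  shows "(\<Prod>i\<in>I. [:- z i, 1:]) dvd q"
  using assms
proof (induction I arbitrary: q)
  case (insert i I)
  then have "[:- z i, 1:] dvd q" by (simp add: poly_eq_0_iff_dvd)
  then obtain s where s: "q = [:- z i, 1:] * s" by (rule dvdE)
  have "poly s (z j) = 0" if "j \<in> I" for j
    using insert.prems insert.hyps that s by (auto simp: inj_on_def)
  then have "(\<Prod>i\<in>I. [:- z i, 1:]) dvd s"
    using insert by (auto simp: inj_on_def)
  then show ?case unfolding prod.insert[OF insert.hyps] s by (rule mult_dvd_mono[OF dvd_refl])
qed simp

lemma degree_prod_linear:
  fixes c :: "'i \<Rightarrow> 'a::idom"
  shows "degree (\<Prod>i\<in>I. [:c i, 1:]) = card I"
  by (subst degree_prod_eq_sum_degree) auto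

lemma lead_coeff_prod_linear:
  fixes c :: "'i \<Rightarrow> 'a::idom"
  shows "lead_coeff (\<Prod>i\<in>I. [:c i, 1:]) = 1"
  by (simp add: lead_coeff_prod)

lemma of_nat_mod_ring_eq_0_iff:
  "(of_nat n :: 'p::prime_card mod_ring) = 0 \<longleftrightarrow> CARD('p) dvd n"
  by (simp add: of_nat_eq_0_iff_char_dvd)

lemma mod_ring_power_card: "x ^ CARD('p) = (x :: 'p::prime_card mod_ring)"
  using finite_field_power_card_eq_same[of x] by simp

section \<open>A lower bound for the degree of a remainder\<close>

text \<open>The derivative of X^p vanishes, so r' = -(q g^(k+1))' is a multiple of g^k; being
  nonzero, it has degree at least |B| k. The exponent is \<open>Suc k\<close>, one more than the
  \<open>k\<close> of the bound.\<close>

lemma degree_monom_card_mod_power: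
  fixes B :: "'p::prime_card mod_ring set"
  assumes B: "card B \<ge> 2" and n: "card B * Suc k \<le> CARD('p)"
  shows "degree (monom 1 (CARD('p)) mod (\<Prod>b\<in>B. [:b, 1:]) ^ Suc k) > card B * k"
proof -
  define g where "g = (\<Prod>b\<in>B. [:b, 1:])"
  define r where "r = monom 1 (CARD('p)) mod g ^ Suc k"
  define q where "q = monom 1 (CARD('p)) div g ^ Suc k"
  have g: "degree g = card B" "g \<noteq> 0"
    unfolding g_def by (simp_all add: degree_prod_linear)
  have eq: "monom 1 (CARD('p)) = q * g ^ Suc k + r"
    unfolding q_def r_def by (rule div_mult_mod_eq[symmetric])
  have deg_r: "degree r < CARD('p)"
  proof (cases "r = 0")
    case False
    then have "degree r < degree (g ^ Suc k)"
      using degree_mod_less'[of "g ^ Suc k" "monom 1 (CARD('p))"] g unfolding r_def by auto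
    also have "\<dots> = card B * Suc k" using g by (simp add: degree_power_eq del: power_Suc)
    finally show ?thesis using n by simp
  qed simp
  have "pderiv (monom 1 (CARD('p)) :: 'p mod_ring poly) = 0"
    by (simp add: pderiv_monom of_nat_mod_ring_eq_0_iff)
  then have "pderiv r = - pderiv (q * g ^ Suc k)"
    using arg_cong[OF eq, of pderiv] by (simp add: pderiv_add eq_neg_iff_add_eq_0 add.commute del: power_Suc)
  also have "\<dots> = - ((pderiv q * g + smult (of_nat (Suc k)) (q * pderiv g)) * g ^ k)"
    unfolding pderiv_mult pderiv_power_Suc by (simp add: algebra_simps)
  finally have dvd: "g ^ k dvd pderiv r" by simp
  have "pderiv r \<noteq> 0"
  proof
    assume "pderiv r = 0"
    \<comment> \<open>As deg r < p, no factor \<open>Suc i\<close> met here is divisible by p, so r'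
      = 0 forces r to be constant.\<close>
    then have "coeff r (Suc i) = 0" for i
    proof (cases "Suc i < CARD('p)")
      case True
      have "of_nat (Suc i) * coeff r (Suc i) = 0"
        using arg_cong[OF \<open>pderiv r = 0\<close>, of "\<lambda>s. coeff s i"] by (simp add: coeff_pderiv)
      moreover have "(of_nat (Suc i) :: 'p mod_ring) \<noteq> 0"
        unfolding of_nat_mod_ring_eq_0_iff using True by (auto dest: dvd_imp_le)
      ultimately show ?thesis by (metis mult_eq_0_iff)
    qed (use deg_r in \<open>auto simp: coeff_eq_0\<close>)
    then have "degree r = 0"
      by (metis leading_coeff_0_iff degree_0 not0_implies_Suc)
    then obtain c where c: "r = [:c:]" by (rule degree_eq_zeroE)
    \<comment> \<open>At the root -b of \<open>g\<close> the division identity reads (-b)^p = c, and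
      (-b)^p = -b.\<close>
    have "- b = c" if "b \<in> B" for b
    proof -
      have "poly g (- b) = 0"
        unfolding g_def using that by (auto simp: poly_prod)
      then show ?thesis
        using arg_cong[OF eq, of "\<lambda>s. poly s (- b)"] c
        by (simp add: poly_monom mod_ring_power_card)
    qed
    then have "B \<subseteq> {- c}" by force
    then have "card B \<le> 1" using card_mono[of "{- c}" B] by simp
    then show False using B by simp
  qed
  then have "card B * k \<le> degree (pderiv r)"
    using dvd_imp_degree_le[OF dvd] g by (simp add: degree_power_eq mult.commute)
  moreover have "degree (pderiv r) < degree r"
  proof (rule ccontr)
    assume "\<not> degree (pderiv r) < degree r"
    then have "coeff (pderiv r) (degree (pderiv r)) = 0"
      by (simp add: coeff_pderiv coeff_eq_0)
    then show False using \<open>pderiv r \<noteq> 0\<close> by simp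
  qed
  ultimately show ?thesis unfolding r_def g_def by linarith
qed

section \<open>Counting the parameters with distinct values\<close>

lemma card_injective_slopes:
  fixes A B :: "'p::prime_card mod_ring set"
  assumes A: "card A = Suc k" "k > 0" and B: "card B \<ge> 2"
  shows "card {y. inj_on (\<lambda>(b, a). a - b * y) (B \<times> A)} \<le> CARD('p) - Suc (card B * k)"
    (is "card ?N \<le> _")
proof (cases "card B * Suc k \<le> CARD('p)")
  case False
  \<comment> \<open>The grid has more than p points, so pigeonhole excludes every \<open>y\<close>,
    whatever the truncated bound is.\<close>
  have "\<not> inj_on f (B \<times> A)" for f :: "_ \<Rightarrow> 'p mod_ring"
  proof
    assume "inj_on f (B \<times> A)"
    from card_inj_on_le[OF this, of UNIV] show False
      using False A by (simp add: card_cartesian_product)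
  qed
  then have "?N = {}" by blast
  then show ?thesis by simp
next
  case True
  define I where "I = B \<times> A"
  define H where "H = (\<lambda>y. \<Prod>i\<in>I. [:fst i * y - snd i, 1:])"
  have I: "finite I" unfolding I_def by simp
  have cI: "card I = card B * Suc k" unfolding I_def using A by (simp add: card_cartesian_product)
  then have "card I \<noteq> 0" using B by (simp only: mult_eq_0_iff) linarith
  then obtain n where n: "card I = Suc n" using not0_implies_Suc by blast
  \<comment> \<open>The top part forgets \<open>a\<close>, so each \<open>b\<close> occurs once for
    every element of \<open>A\<close>.\<close>
  have top: "(\<Prod>i\<in>I. [:fst i, 1:]) = (\<Prod>b\<in>B. [:b, 1:]) ^ Suc k"
  proof -
    have "(\<Prod>i\<in>I. [:fst i, 1:]) = (\<Prod>b\<in>B. \<Prod>a\<in>A. [:b, 1:])"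
      unfolding I_def by (subst prod.cartesian_product) (simp only: case_prod_unfold)
    then show ?thesis by (simp only: prod_constant prod_power_distrib A)
  qed
  define r where "r = monom 1 (CARD('p)) mod (\<Prod>b\<in>B. [:b, 1:]) ^ Suc k"
  have "poly_family (CARD('p)) (\<lambda>y. monom 1 (CARD('p)) mod H y)
      (monom 1 (CARD('p)) mod (\<Prod>i\<in>I. [:fst i, 1:]))"
    unfolding H_def
  proof (rule poly_family_monom_mod)
    show "poly_family (Suc n) (\<lambda>y. \<Prod>i\<in>I. [:fst i * y - snd i, 1:]) (\<Prod>i\<in>I. [:fst i, 1:])"
      using poly_family_prod[OF I, of fst snd] n by simp
  qed ((rule lead_coeff_prod_linear | simp only: degree_prod_linear n)+)
  then obtain c where c:
    "\<And>y j. coeff (monom 1 (CARD('p)) mod H y) j = poly (c j) y"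
    "\<And>i j. i + j > CARD('p) \<Longrightarrow> coeff (c j) i = 0"
    "\<And>i j. i + j = CARD('p) \<Longrightarrow> coeff (c j) i = coeff r j"
    "\<And>j. j > CARD('p) \<Longrightarrow> coeff r j = 0"
    unfolding poly_family_def top r_def by blast
  \<comment> \<open>With this \<open>j\<close> the coefficient of y^(p-j) in \<open>c j\<close> is
    the leading coefficient of \<open>r\<close>, so \<open>c j\<close> is nonzero.\<close>
  define j where "j = degree r"
  have j: "j > card B * k"
    unfolding j_def r_def using B True by (rule degree_monom_card_mod_power)
  have "r \<noteq> 0" using j unfolding j_def by auto
  then have jp: "j \<le> CARD('p)" using c(4)[of j] unfolding j_def by force
  have "coeff (c j) (CARD('p) - j) \<noteq> 0"
    using c(3)[of "CARD('p) - j" j] jp \<open>r \<noteq> 0\<close> unfolding j_def by simp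
  then have cj: "c j \<noteq> 0" by auto
  have deg: "degree (c j) \<le> CARD('p) - j" by (rule degree_le) (use c(2) in auto)
  have "poly (c j) y = 0" if "y \<in> ?N" for y
  proof -
    have H_alt: "H y = (\<Prod>i\<in>I. [:- (snd i - fst i * y), 1:])"
      unfolding H_def by (intro prod.cong) auto
    have "H y dvd monom 1 (CARD('p)) - [:0, 1:]"
      unfolding H_alt using I
      by (rule prod_linear_dvd)
         (use that in \<open>auto simp: I_def case_prod_unfold poly_monom mod_ring_power_card\<close>)
    then have "monom 1 (CARD('p)) mod H y = [:0, 1:] mod H y"
      by (simp add: mod_eq_dvd_iff)
    also have "\<dots> = [:0, 1:]"
    proof (rule mod_poly_less)
      have "degree (H y) = card I"
        unfolding H_def by (rule degree_prod_linear)
      moreover have "2 * 1 < card B * Suc k" using B A by (intro mult_le_less_imp_less) auto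
      ultimately show "degree [:0, 1 :: 'p mod_ring:] < degree (H y)" using cI by simp
    qed
    finally have "poly (c j) y = coeff [:0, 1:] j" using c(1)[of y j] by simp
    \<comment> \<open>The remainder is X itself, whose coefficients vanish only beyond index 1 and
      at 0.\<close>
    moreover have "j > 1"
    proof -
      have "2 * 1 \<le> card B * k" using B A by (intro mult_le_mono) auto
      then show ?thesis using j by linarith
    qed
    ultimately show ?thesis by (simp add: coeff_pCons split: nat.split)
  qed
  then have "?N \<subseteq> {y. poly (c j) y = 0}" by blast
  then have "card ?N \<le> card {y. poly (c j) y = 0}" by (intro card_mono) auto
  also have "\<dots> \<le> degree (c j)" by (rule card_poly_roots_bound[OF cj])
  also have "\<dots> \<le> CARD('p) - Suc (card B * k)" using deg j by linarith
  finally show ?thesis .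
qed

section \<open>From missing slopes to parameters\<close>

theorem theorem4:
  fixes A B :: "'p::prime_card mod_ring set"
  assumes "A \<subseteq> UNIV - {0}"
    and "A \<noteq> {}"
    and "card B \<ge> 2"
  shows "card {a. \<exists>x \<in> (A \<union> difference_set A) - {0}. \<exists>y \<in> difference_set B. a * x = y}
           \<ge> min (CARD('p)) (card A * card B + 1)"
proof -
  let ?S = "{a. \<exists>x \<in> (A \<union> difference_set A) - {0}. \<exists>y \<in> difference_set B. a * x = y}"
  let ?A = "insert 0 A"
  let ?N = "{y. inj_on (\<lambda>(b, a). a - b * y) (B \<times> ?A)}"
  obtain a0 where a0: "a0 \<in> A" "a0 \<noteq> 0" using assms by blast
  obtain b0 where b0: "b0 \<in> B" using assms(3) by fastforce
  \<comment> \<open>Hence every missing \<open>s\<close> is invertible.\<close>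
  have zero: "0 \<in> ?S"
    using a0 b0 by (auto simp: difference_set_def intro!: bexI[of _ a0])
  have eqI: "a = a'" if s: "s \<notin> ?S" and ab: "a \<in> ?A" "a' \<in> ?A" "b \<in> B" "b' \<in> B"
    and eq: "s * (a - a') = b - b'" for s a a' b b'
  proof (rule ccontr)
    assume ne: "a \<noteq> a'"
    have "b - b' \<in> difference_set B" "b' - b \<in> difference_set B"
      using ab unfolding difference_set_def by blast+
    moreover have "s * (a' - a) = b' - b" using eq by (simp add: algebra_simps)
    \<comment> \<open>If one of them is 0, only one sign need lie in \<open>A\<close>; flipping
      signs is harmless because B - B is symmetric.\<close>
    moreover have "a - a' \<in> A \<union> difference_set A - {0} \<or> a' - a \<in> A \<union> difference_set A - {0}"
    proof (cases "a = 0 \<or> a' = 0")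
      case False
      then have "a - a' \<in> difference_set A" using ab unfolding difference_set_def by blast
      then show ?thesis using ne by simp
    qed (use ab ne in auto)
    ultimately show False using s eq by blast
  qed
  have "inverse s \<in> ?N" if s: "s \<notin> ?S" for s
  proof -
    have s0: "s \<noteq> 0" using s zero by metis
    have inj: "a = a' \<and> b = b'" if "a \<in> ?A" "a' \<in> ?A" "b \<in> B" "b' \<in> B"
      and eq: "a - b * inverse s = a' - b' * inverse s" for a a' b b'
    proof -
      have "s * (a - a') = b - b'" using eq s0 by (simp add: field_simps)
      then have "a = a'" using eqI s that by blast
      then show ?thesis using eq s0 by simp
    qed
    have "inj_on (\<lambda>(b, a). a - b * inverse s) (B \<times> ?A)"
    proof (rule inj_onI)
      fix u v
      assume "u \<in> B \<times> ?A" "v \<in> B \<times> ?A"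
        "(\<lambda>(b, a). a - b * inverse s) u = (\<lambda>(b, a). a - b * inverse s) v"
      then show "u = v"
        using inj[of "snd u" "snd v" "fst u" "fst v"]
        unfolding mem_Times_iff case_prod_unfold prod_eq_iff by blast
    qed
    then show ?thesis by blast
  qed
  then have "inverse ` (- ?S) \<subseteq> ?N" by blast
  moreover have "inj_on inverse (- ?S)" by (rule inj_onI) (simp only: inverse_eq_iff_eq)
  ultimately have "card (- ?S) \<le> card ?N" by (intro card_inj_on_le) (simp_all only: finite)
  \<comment> \<open>Adjoining 0, which is not in \<open>A\<close>, gives
    \<open>k = card A\<close>.\<close>
  also have "\<dots> \<le> CARD('p) - Suc (card B * card A)"
    using assms by (intro card_injective_slopes) (auto simp: card_gt_0_iff card_insert_if)
  finally have "card (- ?S) \<le> CARD('p) - Suc (card B * card A)" .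
  moreover have "card (- ?S) = CARD('p) - card ?S"
    unfolding Compl_eq_Diff_UNIV by (subst card_Diff_subset) simp_all
  moreover have "card ?S \<le> CARD('p)"
    using card_mono[of UNIV ?S] by simp
  ultimately show ?thesis unfolding mult.commute[of "card A"] by linarith
qed

end
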